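(* Let $p_1,\dots,p_N$ and $t_1,\dots,t_N>0$ be real numbers with $\frac{p_1}{t_1}\ge\dots\ge\frac{p_N}{t_N}$, and let $k,n\ge1$ be integers with $k+n\le N$. Suppose that for each $i=1,\dots,N$ we have $c\le p_i\le d$ for some $c,d\in(0,1)$ and $0\le t_i\le T$ for some $T$ (with $c,d,T$ independent of $i$). Then $$EXC\le T\,\frac{1-p_{k+n}}{1-p_k}\,\frac{d}{c}\,(1-c)^{k}\left(A-B(1-c)^{n-1}\right),$$ where $$A=1+\frac1c+k+\frac{1-p_k}{1-p_{k+n}}\,\frac{ck}{1-c},\qquad B=\left(1-\frac cd\right)(k+n)+\frac1c.$$
   Context: Here $p_i$ is the success probability and $t_i$ the execution time of the $i$-th solution candidate. $T_m=\sum_{i=1}^m t_i$, $Q_m=\prod_{i=1}^m(1-p_i)$ (empty sums are $0$, empty products are $1$). The quantity $EXC$ (the excess expected time caused by exchanging the $k$-th and $(k+n)$-th candidates in the optimal order) is defined by $EXC=q_1+q_2+q_3$ with $$q_1=T_{k-1}Q_{k-1}(p_{k+n}-p_k)+Q_{k-1}(t_{k+n}p_{k+n}-t_kp_k),$$ $$q_2=\sum_{l=k+1}^{k+n-1}Q_{l-1}\,p_l\left(T_l\,\frac{p_k-p_{k+n}}{1-p_k}+(t_{k+n}-t_k)\frac{1-p_{k+n}}{1-p_k}\right),$$ $$q_3=T_{k+n}\,Q_{k+n-1}\,\frac{p_k-p_{k+n}}{1-p_k}.$$ *)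

theory Defs
  imports Complex_Main
begin

text \<open>
  Candidates are numbered from 1: \<open>p i\<close> is the success probability and \<open>t i\<close> the execution
  time of the \<open>i\<close>-th candidate. Values at index 0 are never used.
\<close>

definition total_time :: "(nat \<Rightarrow> real) \<Rightarrow> nat \<Rightarrow> real" where
  "total_time t m = (\<Sum>i=1..m. t i)"

definition fail_prob :: "(nat \<Rightarrow> real) \<Rightarrow> nat \<Rightarrow> real" where
  "fail_prob p m = (\<Prod>i=1..m. 1 - p i)"

text \<open>
  The truncated differences \<open>k - 1\<close>, \<open>l - 1\<close> and \<open>k + n - 1\<close> below are the true ones
  provided that \<open>k \<ge> 1\<close> and \<open>n \<ge> 1\<close>.
\<close>

definition exc_q1 :: "(nat \<Rightarrow> real) \<Rightarrow> (nat \<Rightarrow> real) \<Rightarrow> nat \<Rightarrow> nat \<Rightarrow> real" where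
  "exc_q1 p t k n =
     total_time t (k - 1) * fail_prob p (k - 1) * (p (k + n) - p k)
     + fail_prob p (k - 1) * (t (k + n) * p (k + n) - t k * p k)"

definition exc_q2 :: "(nat \<Rightarrow> real) \<Rightarrow> (nat \<Rightarrow> real) \<Rightarrow> nat \<Rightarrow> nat \<Rightarrow> real" where
  "exc_q2 p t k n =
     (\<Sum>l=k+1..k+n-1. fail_prob p (l - 1) * p l *
        (total_time t l * ((p k - p (k + n)) / (1 - p k))
         + (t (k + n) - t k) * ((1 - p (k + n)) / (1 - p k))))"

definition exc_q3 :: "(nat \<Rightarrow> real) \<Rightarrow> (nat \<Rightarrow> real) \<Rightarrow> nat \<Rightarrow> nat \<Rightarrow> real" where
  "exc_q3 p t k n =
     total_time t (k + n) * fail_prob p (k + n - 1) * ((p k - p (k + n)) / (1 - p k))"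

text \<open>
  The excess expected time caused by exchanging the \<open>k\<close>-th and the \<open>(k + n)\<close>-th candidate.
\<close>

definition EXC :: "(nat \<Rightarrow> real) \<Rightarrow> (nat \<Rightarrow> real) \<Rightarrow> nat \<Rightarrow> nat \<Rightarrow> real" where
  "EXC p t k n = exc_q1 p t k n + exc_q2 p t k n + exc_q3 p t k n"

definition bound_A :: "(nat \<Rightarrow> real) \<Rightarrow> real \<Rightarrow> nat \<Rightarrow> nat \<Rightarrow> real" where
  "bound_A p c k n =
     1 + 1 / c + real k + (1 - p k) / (1 - p (k + n)) * (c * real k / (1 - c))"

definition bound_B :: "real \<Rightarrow> real \<Rightarrow> nat \<Rightarrow> nat \<Rightarrow> real" where
  "bound_B c d k n = (1 - c / d) * real (k + n) + 1 / c"

end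

theory Submission
  imports Defs
begin

text \<open>
  Every factor \<open>1 - p i\<close> is at most \<open>1 - c\<close>, so the probability that the first \<open>m\<close> candidates all
  fail decays at least like \<open>(1 - c) ^ m\<close>, while the time spent on them grows at most linearly, like
  \<open>m * T\<close>. The three parts of the excess are therefore dominated, term by term, by an
  arithmetico-geometric expression. Write \<open>R = (1 - p (k + n)) / (1 - p k)\<close>; the coefficient
  \<open>(p k - p (k + n)) / (1 - p k)\<close> equals \<open>R - 1\<close> and is below \<open>R\<close>, and likewise
  \<open>t (k + n) - t k \<le> T\<close>. This gives
  \<open>q\<^sub>1 \<le> T * d * k * (1 - c) ^ (k - 1)\<close>,
  \<open>q\<^sub>2 \<le> T * R * d * (\<Sum>l=k+1..k+n-1. (l + 1) * (1 - c) ^ (l - 1))\<close> and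
  \<open>q\<^sub>3 \<le> T * R * (k + n) * (1 - c) ^ (k + n - 1)\<close>.
  The sum has a closed form (\<open>sum_arith_geometric\<close>). The bound on \<open>q\<^sub>1\<close> becomes the last summand of
  \<open>A\<close>, in which the factor \<open>1 / R\<close> cancels the common factor \<open>R\<close>; the closed form supplies the rest
  of \<open>A\<close> and the part \<open>k + n + 1 / c\<close> of \<open>B\<close>; and \<open>q\<^sub>3\<close> accounts for the correction
  \<open>- (c / d) * (k + n)\<close> in \<open>B\<close>.
\<close>

lemma total_time_bounds:
  assumes "\<And>i. i \<in> {1..m} \<Longrightarrow> 0 \<le> t i \<and> t i \<le> T"
  shows "0 \<le> total_time t m" and "total_time t m \<le> real m * T"
proof -
  show "0 \<le> total_time t m"
    unfolding total_time_def using assms by (intro sum_nonneg) auto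
  show "total_time t m \<le> real m * T"
    unfolding total_time_def using sum_bounded_above[of "{1..m}" t T] assms by simp
qed

lemma fail_prob_bounds:
  assumes "\<And>i. i \<in> {1..m} \<Longrightarrow> c \<le> p i \<and> p i \<le> 1"
  shows "0 \<le> fail_prob p m" and "fail_prob p m \<le> (1 - c) ^ m"
proof -
  show "0 \<le> fail_prob p m"
    unfolding fail_prob_def using assms by (intro prod_nonneg) auto
  have "(\<Prod>i=1..m. 1 - p i) \<le> (\<Prod>i=1..m. 1 - c)"
    using assms by (intro prod_mono) auto
  then show "fail_prob p m \<le> (1 - c) ^ m"
    by (simp add: fail_prob_def)
qed

text \<open>
  The sum telescopes: its term for \<open>l\<close> is \<open>g l - g (l + 1)\<close>, where
  \<open>g l = (1 - c) ^ (l - 1) * (l + 1 / c) / c\<close>.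
\<close>

lemma sum_arith_geometric:
  fixes c :: real
  assumes "c \<noteq> 0"
  shows "(\<Sum>l=k+1..k+j. real (l + 1) * (1 - c) ^ (l - 1)) =
    (1 - c) ^ k / c * ((1 + 1 / c + real k) - (1 - c) ^ j * (real (k + j + 1) + 1 / c))"
proof (induction j)
  case 0
  show ?case by simp
next
  case (Suc j)
  have "(\<Sum>l=k+1..k+Suc j. real (l + 1) * (1 - c) ^ (l - 1)) =
      (\<Sum>l=k+1..k+j. real (l + 1) * (1 - c) ^ (l - 1)) + real (k + j + 2) * (1 - c) ^ (k + j)"
    by simp
  also have "\<dots> = (1 - c) ^ k / c *
      ((1 + 1 / c + real k) - (1 - c) ^ Suc j * (real (k + Suc j + 1) + 1 / c))"
    unfolding Suc using assms by (simp add: power_add field_simps)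
  finally show ?case .
qed

context
  fixes p t :: "nat \<Rightarrow> real" and k n :: nat and c d T :: real
  assumes k: "k \<ge> 1" and n: "n \<ge> 1"
    and c: "c > 0" and d: "d < 1"
    and p: "\<And>i. i \<in> {1..k+n} \<Longrightarrow> c \<le> p i \<and> p i \<le> d"
    and t: "\<And>i. i \<in> {1..k+n} \<Longrightarrow> 0 \<le> t i \<and> t i \<le> T"
begin

private lemma pk: "c \<le> p k" "p k \<le> d" and pkn: "c \<le> p (k + n)" "p (k + n) \<le> d"
  and tk: "0 \<le> t k" "t k \<le> T" and tkn: "0 \<le> t (k + n)" "t (k + n) \<le> T"
  using p[of k] p[of "k + n"] t[of k] t[of "k + n"] k by auto

private lemma time_bounds:
  assumes "m \<le> k + n"
  shows "0 \<le> total_time t m" "total_time t m \<le> real m * T"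
proof -
  have hyp: "0 \<le> t i \<and> t i \<le> T" if "i \<in> {1..m}" for i
    using t[of i] assms that by auto
  show "0 \<le> total_time t m" "total_time t m \<le> real m * T"
    using total_time_bounds[of m t T, OF hyp] by auto
qed

private lemma fail_bounds:
  assumes "m \<le> k + n"
  shows "0 \<le> fail_prob p m" "fail_prob p m \<le> (1 - c) ^ m"
proof -
  have hyp: "c \<le> p i \<and> p i \<le> 1" if "i \<in> {1..m}" for i
    using p[of i] assms that d by fastforce
  show "0 \<le> fail_prob p m" "fail_prob p m \<le> (1 - c) ^ m"
    using fail_prob_bounds[of m c p, OF hyp] by auto
qed

text \<open>
  Multiplying a time by \<open>R - 1\<close> may give a negative value; bounding by \<open>R\<close> covers both signs.
\<close>

private lemma time_times_coefficient_le:
  assumes "m \<le> k + n"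
  shows "total_time t m * ((p k - p (k + n)) / (1 - p k))
    \<le> real m * T * ((1 - p (k + n)) / (1 - p k))"
proof (rule order_trans)
  show "total_time t m * ((p k - p (k + n)) / (1 - p k))
      \<le> total_time t m * ((1 - p (k + n)) / (1 - p k))"
    using time_bounds[OF assms] pk d by (intro mult_left_mono divide_right_mono) auto
  show "total_time t m * ((1 - p (k + n)) / (1 - p k))
      \<le> real m * T * ((1 - p (k + n)) / (1 - p k))"
    using time_bounds[OF assms] pk pkn d by (intro mult_right_mono) auto
qed

text \<open>
  Both \<open>p (k + n) - p k\<close> and \<open>p (k + n)\<close> are at most \<open>d\<close>, so the \<open>k - 1\<close> times in \<open>T\<^sub>k\<^sub>-\<^sub>1\<close> and the
  one time \<open>t (k + n)\<close> together contribute at most \<open>k * T * d\<close>.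
\<close>

lemma exc_q1_le: "exc_q1 p t k n \<le> T * d * real k * (1 - c) ^ (k - 1)"
proof -
  have km: "k - 1 \<le> k + n" by simp
  have "total_time t (k - 1) * (p (k + n) - p k) \<le> total_time t (k - 1) * d"
    using time_bounds[OF km] pk pkn c by (intro mult_left_mono) auto
  also have "\<dots> \<le> real (k - 1) * T * d"
    using time_bounds[OF km] pk c by (intro mult_right_mono) auto
  finally have 1: "total_time t (k - 1) * (p (k + n) - p k) \<le> real (k - 1) * T * d" .
  have "t (k + n) * p (k + n) \<le> T * d"
    using tkn pkn c by (intro mult_mono) auto
  moreover have "0 \<le> t k * p k"
    using tk pk c by simp
  ultimately have 2: "t (k + n) * p (k + n) - t k * p k \<le> T * d"
    by linarith
  have "exc_q1 p t k n = fail_prob p (k - 1) * (total_time t (k - 1) * (p (k + n) - p k)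
      + (t (k + n) * p (k + n) - t k * p k))"
    by (simp add: exc_q1_def algebra_simps)
  also have "\<dots> \<le> fail_prob p (k - 1) * (real k * T * d)"
  proof (rule mult_left_mono)
    have "real (k - 1) * T * d + T * d = real k * T * d"
      using k by (simp add: of_nat_diff algebra_simps)
    then show "total_time t (k - 1) * (p (k + n) - p k) + (t (k + n) * p (k + n) - t k * p k)
        \<le> real k * T * d"
      using 1 2 by linarith
  qed (rule fail_bounds[OF km])
  also have "\<dots> \<le> (1 - c) ^ (k - 1) * (real k * T * d)"
    using fail_bounds[OF km] tk pk c by (intro mult_right_mono) auto
  finally show ?thesis
    by (simp add: mult_ac)
qed

lemma exc_q2_le:
  "exc_q2 p t k n \<le> T * ((1 - p (k + n)) / (1 - p k)) * d *
    (\<Sum>l=k+1..k+n-1. real (l + 1) * (1 - c) ^ (l - 1))"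
proof -
  define R where "R = (1 - p (k + n)) / (1 - p k)"
  have R: "0 \<le> R" using pk pkn d by (simp add: R_def)
  have T: "0 \<le> T" using tk by simp
  have "fail_prob p (l - 1) * p l *
      (total_time t l * ((p k - p (k + n)) / (1 - p k)) + (t (k + n) - t k) * R)
      \<le> T * R * d * (real (l + 1) * (1 - c) ^ (l - 1))"
    if l: "l \<in> {k+1..k+n-1}" for l
  proof -
    have pl: "c \<le> p l" "p l \<le> d" using p[of l] l by auto
    have f: "0 \<le> fail_prob p (l - 1)" "fail_prob p (l - 1) \<le> (1 - c) ^ (l - 1)"
      using fail_bounds[of "l - 1"] l by auto
    have "total_time t l * ((p k - p (k + n)) / (1 - p k)) \<le> real l * T * R"
      unfolding R_def using l by (intro time_times_coefficient_le) auto
    moreover have "(t (k + n) - t k) * R \<le> T * R"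
      using tk tkn R by (intro mult_right_mono) auto
    ultimately have "total_time t l * ((p k - p (k + n)) / (1 - p k)) + (t (k + n) - t k) * R
        \<le> real (l + 1) * T * R"
      by (simp add: algebra_simps)
    then have "fail_prob p (l - 1) * p l *
        (total_time t l * ((p k - p (k + n)) / (1 - p k)) + (t (k + n) - t k) * R)
        \<le> fail_prob p (l - 1) * p l * (real (l + 1) * T * R)"
      using f pl c by (intro mult_left_mono) auto
    also have "\<dots> \<le> (1 - c) ^ (l - 1) * d * (real (l + 1) * T * R)"
      using f pl c T R by (intro mult_right_mono mult_mono) auto
    finally show ?thesis
      by (simp add: mult_ac)
  qed
  then have "exc_q2 p t k n
      \<le> (\<Sum>l=k+1..k+n-1. T * R * d * (real (l + 1) * (1 - c) ^ (l - 1)))"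
    unfolding exc_q2_def R_def by (intro sum_mono)
  then show ?thesis
    by (simp only: R_def sum_distrib_left)
qed

lemma exc_q3_le:
  "exc_q3 p t k n \<le> T * ((1 - p (k + n)) / (1 - p k)) * real (k + n) * (1 - c) ^ (k + n - 1)"
proof -
  define R where "R = (1 - p (k + n)) / (1 - p k)"
  have R: "0 \<le> R" using pk pkn d by (simp add: R_def)
  have T: "0 \<le> T" using tk by simp
  have f: "0 \<le> fail_prob p (k + n - 1)" "fail_prob p (k + n - 1) \<le> (1 - c) ^ (k + n - 1)"
    using fail_bounds[of "k + n - 1"] by auto
  have "exc_q3 p t k n = fail_prob p (k + n - 1) *
      (total_time t (k + n) * ((p k - p (k + n)) / (1 - p k)))"
    by (simp add: exc_q3_def)
  also have "\<dots> \<le> fail_prob p (k + n - 1) * (real (k + n) * T * R)"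
    unfolding R_def using f time_times_coefficient_le[of "k + n"] by (intro mult_left_mono) auto
  also have "\<dots> \<le> (1 - c) ^ (k + n - 1) * (real (k + n) * T * R)"
    using f T R by (intro mult_right_mono) auto
  finally show ?thesis
    by (simp add: R_def mult_ac)
qed

end

theorem theorem4p2:
  fixes p t :: "nat \<Rightarrow> real" and N k n :: nat and c d T :: real
  assumes "\<And>i. i \<in> {1..N} \<Longrightarrow> t i > 0"
    and "\<And>i. 1 \<le> i \<Longrightarrow> i < N \<Longrightarrow> p i / t i \<ge> p (i + 1) / t (i + 1)"
    and "k \<ge> 1" and "n \<ge> 1" and "k + n \<le> N"
    and "c \<in> {0<..<1}" and "d \<in> {0<..<1}"
    and "\<And>i. i \<in> {1..N} \<Longrightarrow> c \<le> p i \<and> p i \<le> d"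
    and "\<And>i. i \<in> {1..N} \<Longrightarrow> 0 \<le> t i \<and> t i \<le> T"
  shows "EXC p t k n \<le>
    T * ((1 - p (k + n)) / (1 - p k)) * (d / c) * (1 - c) ^ k
      * (bound_A p c k n - bound_B c d k n * (1 - c) ^ (n - 1))"
proof -
  define R where "R = (1 - p (k + n)) / (1 - p k)"
  have c: "0 < c" "c < 1" and d: "0 < d" "d < 1" using assms(6,7) by auto
  have p: "c \<le> p i \<and> p i \<le> d" if "i \<in> {1..k+n}" for i
    using assms(5,8) that by auto
  have t: "0 \<le> t i \<and> t i \<le> T" if "i \<in> {1..k+n}" for i
    using assms(5,9) that by auto
  have R: "R \<noteq> 0"
    using p[of k] p[of "k + n"] assms(3) d by (auto simp: R_def)
  have inv_R: "(1 - p k) / (1 - p (k + n)) = 1 / R"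
    by (simp add: R_def)
  obtain j where j: "n = Suc j" using assms(4) by (cases n) auto
  obtain i where i: "k = Suc i" using assms(3) by (cases k) auto
  note bounds_hyps = assms(3,4) c(1) d(2) p t
  define K where "K = T * R * (d / c) * (1 - c) ^ k"
  define S where "S = (1 + 1 / c + real k) - (1 - c) ^ (n - 1) * (real (k + n) + 1 / c)"
  have "EXC p t k n \<le> T * d * real k * (1 - c) ^ (k - 1)
      + T * R * d * (\<Sum>l=k+1..k+n-1. real (l + 1) * (1 - c) ^ (l - 1))
      + T * R * real (k + n) * (1 - c) ^ (k + n - 1)"
    unfolding EXC_def R_def
    by (intro add_mono exc_q1_le[OF bounds_hyps] exc_q2_le[OF bounds_hyps]
        exc_q3_le[OF bounds_hyps])
  also have "(\<Sum>l=k+1..k+n-1. real (l + 1) * (1 - c) ^ (l - 1)) = (1 - c) ^ k / c * S"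
    using sum_arith_geometric[of c k j] c by (simp add: j S_def)
  also have "T * R * d * ((1 - c) ^ k / c * S) = K * S"
    by (simp add: K_def)
  also have "T * d * real k * (1 - c) ^ (k - 1) = K * (1 / R * (c * real k / (1 - c)))"
    using R c by (simp add: K_def i)
  also have "T * R * real (k + n) * (1 - c) ^ (k + n - 1) =
      K * (c / d * real (k + n) * (1 - c) ^ (n - 1))"
    using c d by (simp add: K_def j power_add)
  also have "K * (1 / R * (c * real k / (1 - c))) + K * S
        + K * (c / d * real (k + n) * (1 - c) ^ (n - 1)) =
      K * (1 + 1 / c + real k + 1 / R * (c * real k / (1 - c))
        - ((1 - c / d) * real (k + n) + 1 / c) * (1 - c) ^ (n - 1))"
    unfolding S_def by algebra
  finally show ?thesis
    by (simp only: bound_A_def bound_B_def inv_R K_def R_def[symmetric])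
qed

end
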